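(* Let $0<\rho<1$. Let $\psi_s=\frac{\pi}{2}-\frac12\arctan\frac{2}{1-\rho}$ and $\psi_a=\frac12\arctan\frac{2}{1+\rho}$, so that $$\tan 2\psi_s=\frac{-2}{1-\rho},\qquad \tan2\psi_a=\frac{2}{1+\rho}.$$ Then the 4-point AR(1) Karhunen--Loève transform is one butterfly followed by two plane rotations: up to the signs of the rows, $$\mathbf{W}_4(\rho)=\mathbf{P}_4\begin{pmatrix}G(\psi_s)^T&0\\0&G(\psi_a)^T\end{pmatrix}\mathbf{B}_4 .$$ Moreover, $(\psi_s,\psi_a)\to(\pi/4,\pi/8)$ as $\rho\to1$, and $(\psi_s,\psi_a)\to(\arctan\phi,\tfrac12\arctan2)$ with $\phi=(1+\sqrt5)/2$ as $\rho\to0$.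
   Context: All indices start at $0$. $\mathbf{R}_N(\rho)=[\rho^{|i-j|}]_{i,j=0}^{N-1}$ is the AR(1) covariance matrix. Its Karhunen--Loève transform (KLT) $\mathbf{W}_N(\rho)$ is the orthogonal matrix whose rows are the unit eigenvectors of $\mathbf{R}_N(\rho)$, ordered by decreasing eigenvalue (each row determined up to sign). $G(\psi)=\begin{pmatrix}\cos\psi&-\sin\psi\\ \sin\psi&\cos\psi\end{pmatrix}$. $\mathbf{B}_4=\frac{1}{\sqrt2}\begin{pmatrix}\mathbf{I}_2&\mathbf{J}_2\\ \mathbf{I}_2&-\mathbf{J}_2\end{pmatrix}$, where $\mathbf{I}_2$ is the identity and $\mathbf{J}_2$ the $2\times2$ order-reversal matrix. $\mathbf{P}_4$ is the $4\times4$ permutation matrix with $[\mathbf{P}_4]_{2i,\,i}=[\mathbf{P}_4]_{2i+1,\,2+i}=1$ for $i=0,1$ and all other entries zero. *)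

theory Defs
  imports Complex_Main "Jordan_Normal_Form.Char_Poly"
begin

definition AR1 :: "nat \<Rightarrow> real \<Rightarrow> real mat" where
  "AR1 N \<rho> = mat N N (\<lambda>(i, j). \<rho> ^ nat \<bar>int i - int j\<bar>)"

text \<open>
  The transform is determined only up to the signs of its rows (and, for repeated eigenvalues,
  not even that far), so it is rendered as a predicate. The order is weakly decreasing; simplicity
  of the spectrum is not presupposed. The rows are unit vectors by \<open>W * W\<^sup>T = 1\<^sub>m N\<close>.
\<close>

definition is_KLT :: "nat \<Rightarrow> real \<Rightarrow> real mat \<Rightarrow> bool" where
  "is_KLT N \<rho> W \<longleftrightarrow>
     W \<in> carrier_mat N N \<and> W * W\<^sup>T = 1\<^sub>m N \<and>
     (\<exists>ev :: nat \<Rightarrow> real.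
        (\<forall>i < N. eigenvector (AR1 N \<rho>) (row W i) (ev i)) \<and>
        (\<forall>i j. i < j \<and> j < N \<longrightarrow> ev j \<le> ev i))"

definition eq_up_to_row_signs :: "real mat \<Rightarrow> real mat \<Rightarrow> bool" where
  "eq_up_to_row_signs A B \<longleftrightarrow>
     dim_row A = dim_row B \<and> dim_col A = dim_col B \<and>
     (\<forall>i < dim_row A. row A i = row B i \<or> row A i = - row B i)"

definition G :: "real \<Rightarrow> real mat" where
  "G \<psi> = mat_of_rows_list 2 [[cos \<psi>, - sin \<psi>], [sin \<psi>, cos \<psi>]]"

definition J2 :: "real mat" where
  "J2 = mat_of_rows_list 2 [[0, 1], [1, 0]]"

definition B4 :: "real mat" where
  "B4 = (1 / sqrt 2) \<cdot>\<^sub>m four_block_mat (1\<^sub>m 2) J2 (1\<^sub>m 2) (- J2)"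

definition P4 :: "real mat" where
  "P4 = mat 4 4 (\<lambda>(r, c).
     if \<exists>i < 2. (r = 2 * i \<and> c = i) \<or> (r = 2 * i + 1 \<and> c = 2 + i) then 1 else 0)"

definition psi_s :: "real \<Rightarrow> real" where
  "psi_s \<rho> = pi / 2 - 1 / 2 * arctan (2 / (1 - \<rho>))"

definition psi_a :: "real \<Rightarrow> real" where
  "psi_a \<rho> = 1 / 2 * arctan (2 / (1 + \<rho>))"

definition butterfly_rotations :: "real \<Rightarrow> real mat" where
  "butterfly_rotations \<rho> =
     P4 * four_block_mat ((G (psi_s \<rho>))\<^sup>T) (0\<^sub>m 2 2) (0\<^sub>m 2 2) ((G (psi_a \<rho>))\<^sup>T) * B4"

end

(*
  The butterfly splits R into its actions on symmetric and antisymmetric vectors, two symmetric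
  2x2 blocks, and the double angles 2 psi_s, 2 psi_a are exactly those that diagonalise them.
  The four eigenvalues interlace strictly, so the interleaving permutation P4 sorts them, and
  simplicity of the spectrum makes the transform unique up to signs: the change of basis between
  two orthonormal eigenbases is a signed permutation, and the ordering forces it to be diagonal.
*)

theory Submission
  imports Defs "HOL-Real_Asymp.Real_Asymp"
begin

section \<open>Rigidity of ordered orthonormal eigenbases\<close>

text \<open>Each step raises \<open>f\<close> by at least 1: counting up from 0 bounds
  \<open>f i\<close> below, counting from \<open>i\<close> up to the last index \<open>n - 1\<close>
  bounds it above. Below, this turns a monotone matching of eigenvalue indices into the
  identity.\<close>

lemma strict_mono_self_map_lessThan_eq_id:
  fixes f :: "nat \<Rightarrow> nat"
  assumes mono: "\<And>i j. i < j \<Longrightarrow> j < n \<Longrightarrow> f i < f j"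
    and range: "\<And>i. i < n \<Longrightarrow> f i < n" and "i < n"
  shows "f i = i"
proof -
  have step: "f j + k \<le> f (j + k)" if "j + k < n" for j k
    using that
  proof (induction k)
    case (Suc k)
    then show ?case using mono[of "j + k" "j + Suc k"] by simp
  qed simp
  have "i \<le> f i" using step[of 0 i] \<open>i < n\<close> by simp
  moreover have "f i \<le> i"
    using step[of i "n - 1 - i"] range[of "n - 1"] \<open>i < n\<close> by simp
  ultimately show ?thesis by simp
qed

text \<open>Strict order is asked of the reference basis \<open>V\<close> only; \<open>W\<close> is
  ordered weakly, as in \<open>is_KLT\<close>, since its eigenvalues are not known
  beforehand.\<close>

lemma eq_up_to_row_signs_if_eigenvectors:
  fixes A V W :: "real mat"
  assumes A: "A \<in> carrier_mat n n" "A\<^sup>T = A"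
    and V: "V \<in> carrier_mat n n" "V * V\<^sup>T = 1\<^sub>m n"
    and W: "W \<in> carrier_mat n n" "W * W\<^sup>T = 1\<^sub>m n"
    and eV: "\<And>i. i < n \<Longrightarrow> eigenvector A (row V i) (\<mu> i)"
    and eW: "\<And>i. i < n \<Longrightarrow> eigenvector A (row W i) (ev i)"
    and \<mu>: "\<And>i j. i < j \<Longrightarrow> j < n \<Longrightarrow> \<mu> j < \<mu> i"
    and ev: "\<And>i j. i < j \<Longrightarrow> j < n \<Longrightarrow> ev j \<le> ev i"
  shows "eq_up_to_row_signs W V"
proof -
  define C where "C = W * V\<^sup>T"
  have C: "C \<in> carrier_mat n n" using V W by (simp add: C_def)
  have VV: "V\<^sup>T * V = 1\<^sub>m n"
    using V mat_mult_left_right_inverse[of V n "V\<^sup>T"] by simp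
  have CV: "W = C * V"
    using V W VV by (simp add: C_def assoc_mult_mat[of _ n n _ n _ n])
  have Ct: "C\<^sup>T = V * W\<^sup>T"
    using V W by (simp add: C_def transpose_mult[of _ n n _ n])
  have CC: "C * C\<^sup>T = 1\<^sub>m n"
  proof -
    have "C * C\<^sup>T = C * (V * W\<^sup>T)" by (simp add: Ct)
    also have "\<dots> = (C * V) * W\<^sup>T"
      using C V W by (simp add: assoc_mult_mat[of _ n n _ n _ n])
    finally show ?thesis using CV W by simp
  qed
  \<comment> \<open>Symmetry of \<open>A\<close> lets it act on either factor of the inner product,
    so distinct eigenvalues force a zero entry of \<open>C\<close>.\<close>
  have eig: "C $$ (i, j) * (ev i - \<mu> j) = 0" if "i < n" "j < n" for i j
  proof -
    have c: "C $$ (i, j) = row W i \<bullet> row V j"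
      using that V W by (simp add: C_def)
    have w: "row W i \<in> carrier_vec n" and v: "row V j \<in> carrier_vec n"
      using that V W by auto
    have "(A *\<^sub>v row W i) \<bullet> row V j = row W i \<bullet> (A *\<^sub>v row V j)"
      using A w v transpose_vec_mult_scalar[of A n n "row V j" "row W i"]
      by metis
    moreover have "A *\<^sub>v row W i = ev i \<cdot>\<^sub>v row W i" "A *\<^sub>v row V j = \<mu> j \<cdot>\<^sub>v row V j"
      using eV[OF that(2)] eW[OF that(1)] by (auto simp: eigenvector_def)
    ultimately show ?thesis using w v by (simp add: c algebra_simps)
  qed
  have dot: "(\<Sum>k<n. C $$ (i, k) * C $$ (j, k)) = (if i = j then 1 else 0)"
    if "i < n" "j < n" for i j
  proof -
    have "(C * C\<^sup>T) $$ (i, j) = (\<Sum>k<n. C $$ (i, k) * C $$ (j, k))"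
      using that C by (simp add: scalar_prod_def lessThan_atLeast0)
    then show ?thesis using that CC by simp
  qed
  \<comment> \<open>Rows of \<open>C\<close> have unit norm, so none vanishes and each row
    \<open>i\<close> selects a column \<open>\<sigma> i\<close>.\<close>
  have "\<exists>j<n. C $$ (i, j) \<noteq> 0" if "i < n" for i
  proof (rule ccontr)
    assume "\<not> ?thesis"
    then show False using dot[OF that that] by simp
  qed
  then obtain \<sigma> where \<sigma>: "\<And>i. i < n \<Longrightarrow> \<sigma> i < n \<and> C $$ (i, \<sigma> i) \<noteq> 0"
    by metis
  have ev\<sigma>: "ev i = \<mu> (\<sigma> i)" if "i < n" for i
    using eig[of i "\<sigma> i"] \<sigma>[OF that] that by simp
  have \<mu>inj: "\<mu> i \<noteq> \<mu> j" if "i < n" "j < n" "i \<noteq> j" for i j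
    using \<mu>[of i j] \<mu>[of j i] that by linarith
  have off: "C $$ (i, j) = 0" if "i < n" "j < n" "j \<noteq> \<sigma> i" for i j
    using eig[of i j] \<mu>inj[of j "\<sigma> i"] ev\<sigma>[of i] \<sigma>[of i] that by force
  have dot\<sigma>: "(\<Sum>k<n. C $$ (i, k) * C $$ (j, k)) = C $$ (i, \<sigma> i) * C $$ (j, \<sigma> i)"
    if "i < n" "j < n" for i j
  proof -
    have "(\<Sum>k<n. C $$ (i, k) * C $$ (j, k)) = (\<Sum>k\<in>{\<sigma> i}. C $$ (i, k) * C $$ (j, k))"
      using \<sigma>[OF that(1)] that by (intro sum.mono_neutral_right) (auto simp: off)
    then show ?thesis by simp
  qed
  have "\<sigma> i < \<sigma> j" if "i < j" "j < n" for i j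
  proof -
    \<comment> \<open>Otherwise the inner product of two orthogonal rows of \<open>C\<close> would
      be a product of two nonzero entries.\<close>
    have "\<sigma> i \<noteq> \<sigma> j"
      using dot[of i j] dot\<sigma>[of i j] \<sigma>[of i] \<sigma>[of j] that by auto
    \<comment> \<open>A descent of \<open>\<sigma>\<close> would give \<open>ev i < ev j\<close>,
      against the weak order.\<close>
    moreover have "\<not> \<sigma> j < \<sigma> i"
      using ev[OF that] \<mu>[of "\<sigma> j" "\<sigma> i"] ev\<sigma>[of i] ev\<sigma>[of j] \<sigma>[of i] that by auto
    ultimately show ?thesis by simp
  qed
  then have \<sigma>id: "\<sigma> i = i" if "i < n" for i
    using \<sigma> that by (intro strict_mono_self_map_lessThan_eq_id[of n]) auto
  have "row W i = row V i \<or> row W i = - row V i" if i: "i < n" for i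
  proof -
    have entry: "W $$ (i, j) = C $$ (i, i) * V $$ (i, j)" if j: "j < n" for j
    proof -
      have "W $$ (i, j) = (\<Sum>k<n. C $$ (i, k) * V $$ (k, j))"
        using i j C V by (subst CV) (simp add: scalar_prod_def lessThan_atLeast0)
      also have "\<dots> = (\<Sum>k\<in>{i}. C $$ (i, k) * V $$ (k, j))"
        using i by (intro sum.mono_neutral_right) (auto simp: off \<sigma>id)
      finally show ?thesis by simp
    qed
    have "C $$ (i, i) * C $$ (i, i) = 1"
      using dot[OF i i] dot\<sigma>[OF i i] \<sigma>id[OF i] by simp
    then have "C $$ (i, i) = 1 \<or> C $$ (i, i) = - 1"
      by (simp add: square_eq_1_iff)
    then show ?thesis
    proof
      assume "C $$ (i, i) = 1"
      then have "row W i = row V i" using i V W entry by (intro eq_vecI) auto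
      then show ?thesis ..
    next
      assume "C $$ (i, i) = - 1"
      then have "row W i = - row V i" using i V W entry by (intro eq_vecI) auto
      then show ?thesis ..
    qed
  qed
  then show ?thesis using V W by (auto simp: eq_up_to_row_signs_def)
qed

section \<open>The AR(1) matrix on symmetric and antisymmetric vectors\<close>

lemma AR1_carrier [simp]: "AR1 N \<rho> \<in> carrier_mat N N"
  by (simp add: AR1_def)

lemma AR1_transpose: "(AR1 N \<rho>)\<^sup>T = AR1 N \<rho>"
  by (rule eq_matI) (auto simp: AR1_def abs_minus_commute)

lemma sum_upt_4: "(\<Sum>i = 0..<4. f i) = f 0 + f 1 + f 2 + f (3 :: nat)" for f :: "nat \<Rightarrow> real"
  by (simp add: numeral_eq_Suc)

lemma less_4_cases: "i < 4 \<longleftrightarrow> i = 0 \<or> i = 1 \<or> i = 2 \<or> i = (3 :: nat)"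
  by auto

text \<open>
  On symmetric and antisymmetric vectors the eigenvalue equation folds to a
  \<open>2 \<times> 2\<close> system: the two diagonal blocks of \<open>B4 * AR1 4 \<rho> * B4\<^sup>T\<close>.
\<close>

lemma AR1_4_eigenvector_symmetric:
  assumes "(1 + \<rho> ^ 3) * x + (\<rho> + \<rho>\<^sup>2) * y = k * x"
    and "(\<rho> + \<rho>\<^sup>2) * x + (1 + \<rho>) * y = k * y" and "x \<noteq> 0 \<or> y \<noteq> 0"
  shows "eigenvector (AR1 4 \<rho>) (vec 4 ((!) [x, y, y, x])) k"
  unfolding eigenvector_def
proof (intro conjI)
  show "vec 4 ((!) [x, y, y, x]) \<noteq> 0\<^sub>v (dim_row (AR1 4 \<rho>))"
  proof
    assume *: "vec 4 ((!) [x, y, y, x]) = 0\<^sub>v (dim_row (AR1 4 \<rho>))"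
    have "vec 4 ((!) [x, y, y, x]) $ 0 = 0" "vec 4 ((!) [x, y, y, x]) $ 1 = 0"
      unfolding * by (simp_all add: AR1_def)
    then show False using assms(3) by simp
  qed
  let ?u = "(1 + \<rho> ^ 3) * x + (\<rho> + \<rho>\<^sup>2) * y"
  let ?w = "(\<rho> + \<rho>\<^sup>2) * x + (1 + \<rho>) * y"
  have "AR1 4 \<rho> *\<^sub>v vec 4 ((!) [x, y, y, x]) = vec 4 ((!) [?u, ?w, ?w, ?u])"
    by (rule eq_vecI)
      (auto simp: AR1_def scalar_prod_def sum_upt_4 less_4_cases algebra_simps
        power2_eq_square power3_eq_cube)
  also have "\<dots> = k \<cdot>\<^sub>v vec 4 ((!) [x, y, y, x])"
    unfolding assms(1,2) by (rule eq_vecI) (auto simp: less_4_cases)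
  finally show "AR1 4 \<rho> *\<^sub>v vec 4 ((!) [x, y, y, x]) = k \<cdot>\<^sub>v vec 4 ((!) [x, y, y, x])" .
qed (simp add: AR1_def)

lemma AR1_4_eigenvector_antisymmetric:
  assumes "(1 - \<rho> ^ 3) * x + (\<rho> - \<rho>\<^sup>2) * y = k * x"
    and "(\<rho> - \<rho>\<^sup>2) * x + (1 - \<rho>) * y = k * y" and "x \<noteq> 0 \<or> y \<noteq> 0"
  shows "eigenvector (AR1 4 \<rho>) (vec 4 ((!) [x, y, - y, - x])) k"
  unfolding eigenvector_def
proof (intro conjI)
  show "vec 4 ((!) [x, y, - y, - x]) \<noteq> 0\<^sub>v (dim_row (AR1 4 \<rho>))"
  proof
    assume *: "vec 4 ((!) [x, y, - y, - x]) = 0\<^sub>v (dim_row (AR1 4 \<rho>))"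
    have "vec 4 ((!) [x, y, - y, - x]) $ 0 = 0" "vec 4 ((!) [x, y, - y, - x]) $ 1 = 0"
      unfolding * by (simp_all add: AR1_def)
    then show False using assms(3) by simp
  qed
  let ?u = "(1 - \<rho> ^ 3) * x + (\<rho> - \<rho>\<^sup>2) * y"
  let ?w = "(\<rho> - \<rho>\<^sup>2) * x + (1 - \<rho>) * y"
  have "AR1 4 \<rho> *\<^sub>v vec 4 ((!) [x, y, - y, - x]) = vec 4 ((!) [?u, ?w, - ?w, - ?u])"
    by (rule eq_vecI)
      (auto simp: AR1_def scalar_prod_def sum_upt_4 less_4_cases algebra_simps
        power2_eq_square power3_eq_cube)
  also have "\<dots> = k \<cdot>\<^sub>v vec 4 ((!) [x, y, - y, - x])"
    unfolding assms(1,2) by (rule eq_vecI) (auto simp: less_4_cases)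
  finally show "AR1 4 \<rho> *\<^sub>v vec 4 ((!) [x, y, - y, - x]) = k \<cdot>\<^sub>v vec 4 ((!) [x, y, - y, - x])" .
qed (simp add: AR1_def)

section \<open>Explicit entries of the factored transform\<close>

text \<open>Exhibits rows 0, 2 in the shape \<open>[x, y, y, x]\<close> and rows 1, 3 in the shape
  \<open>[x, y, - y, - x]\<close>, ready for the folded eigenvalue equations.\<close>

lemma butterfly_rotations_eq:
  fixes \<rho> :: real
  defines "c \<equiv> cos (psi_s \<rho>) / sqrt 2" and "s \<equiv> sin (psi_s \<rho>) / sqrt 2"
    and "c' \<equiv> cos (psi_a \<rho>) / sqrt 2" and "s' \<equiv> sin (psi_a \<rho>) / sqrt 2"
  shows "butterfly_rotations \<rho> = mat 4 4 (\<lambda>(i, j).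
    [[c, s, s, c], [c', s', - s', - c'], [- s, c, c, - s], [- s', c', - c', s']] ! i ! j)"
proof -
  let ?D = "four_block_mat ((G (psi_s \<rho>))\<^sup>T) (0\<^sub>m 2 2) (0\<^sub>m 2 2) ((G (psi_a \<rho>))\<^sup>T)"
  let ?r = "sqrt 2"
  \<comment> \<open>The factor \<open>?r\<close> compensates the division by \<open>sqrt 2\<close>
    built into \<open>c\<close>, \<open>s\<close>, \<open>c'\<close>, \<open>s'\<close>; it later
    cancels against \<open>B4\<close>.\<close>
  have D: "?D = mat 4 4 (\<lambda>(i, j).
    [[?r * c, ?r * s, 0, 0], [- (?r * s), ?r * c, 0, 0],
     [0, 0, ?r * c', ?r * s'], [0, 0, - (?r * s'), ?r * c']] ! i ! j)"
    by (rule eq_matI)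
      (auto simp: G_def mat_of_rows_list_def less_4_cases c_def s_def c'_def s'_def)
  have B: "B4 = mat 4 4 (\<lambda>(i, j).
    [[1 / ?r, 0, 0, 1 / ?r], [0, 1 / ?r, 1 / ?r, 0],
     [1 / ?r, 0, 0, - (1 / ?r)], [0, 1 / ?r, - (1 / ?r), 0]] ! i ! j)"
    by (rule eq_matI)
      (auto simp: B4_def J2_def mat_of_rows_list_def less_4_cases)
  have P: "P4 = mat 4 4 (\<lambda>(i, j).
    [[1, 0, 0, 0], [0, 0, 1, 0], [0, 1, 0, 0], [0, 0, 0, 1]] ! i ! j)"
    by (rule eq_matI)
      (auto simp: P4_def less_4_cases less_2_cases_iff)
  have PD: "P4 * ?D = mat 4 4 (\<lambda>(i, j).
    [[?r * c, ?r * s, 0, 0], [0, 0, ?r * c', ?r * s'],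
     [- (?r * s), ?r * c, 0, 0], [0, 0, - (?r * s'), ?r * c']] ! i ! j)"
    unfolding D P
    by (intro eq_matI)
      (auto simp: scalar_prod_def sum_upt_4 less_4_cases)
  show ?thesis
    unfolding butterfly_rotations_def PD B
    by (rule eq_matI)
      (auto simp: scalar_prod_def sum_upt_4 less_4_cases)
qed

section \<open>Double angles of the two rotations\<close>

text \<open>Difference formulas for \<open>2 * \<psi> - \<psi>\<close>. Geometrically, the
  reflection with rows \<open>(cos (2 * \<psi>), sin (2 * \<psi>))\<close> and
  \<open>(sin (2 * \<psi>), - cos (2 * \<psi>))\<close> fixes the unit vector at angle
  \<open>\<psi>\<close>.\<close>

lemma double_angle_cos_sin:
  fixes \<psi> :: real
  shows "cos (2 * \<psi>) * cos \<psi> + sin (2 * \<psi>) * sin \<psi> = cos \<psi>"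
    and "sin (2 * \<psi>) * cos \<psi> - cos (2 * \<psi>) * sin \<psi> = sin \<psi>"
  using cos_diff[of "2 * \<psi>" \<psi>] sin_diff[of "2 * \<psi>" \<psi>] by simp_all

text \<open>Read off the right triangle with legs \<open>x\<close> and 2.\<close>

lemma cos_sin_arctan_2_div:
  fixes x :: real
  assumes "0 < x"
  shows "sqrt (x\<^sup>2 + 4) * cos (arctan (2 / x)) = x"
    and "sqrt (x\<^sup>2 + 4) * sin (arctan (2 / x)) = 2"
proof -
  have "1 + (2 / x)\<^sup>2 = (x\<^sup>2 + 4) / x\<^sup>2"
    using assms by (simp add: field_simps)
  then have *: "sqrt (1 + (2 / x)\<^sup>2) = sqrt (x\<^sup>2 + 4) / x"
    using assms by (simp add: real_sqrt_divide)
  have "sqrt (x\<^sup>2 + 4) > 0" by (simp add: add_nonneg_pos)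
  then show "sqrt (x\<^sup>2 + 4) * cos (arctan (2 / x)) = x"
    and "sqrt (x\<^sup>2 + 4) * sin (arctan (2 / x)) = 2"
    using assms by (simp_all add: cos_arctan sin_arctan *)
qed

text \<open>In the symmetric block, \<open>(a - d) / 2\<close> and \<open>b\<close> are
  \<open>\<rho> * (1 + \<rho>) / 2\<close> times \<open>- (1 - \<rho>)\<close> and 2. For positive
  \<open>\<rho>\<close> the doubled angle thus lies in the second quadrant, whence the supplement
  \<open>pi - arctan\<close>.\<close>

lemma cos_sin_double_psi_s:
  assumes "\<rho> < 1"
  shows "sqrt ((1 - \<rho>)\<^sup>2 + 4) * cos (2 * psi_s \<rho>) = - (1 - \<rho>)"
    and "sqrt ((1 - \<rho>)\<^sup>2 + 4) * sin (2 * psi_s \<rho>) = 2"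
proof -
  have *: "2 * psi_s \<rho> = pi - arctan (2 / (1 - \<rho>))" by (simp add: psi_s_def)
  show "sqrt ((1 - \<rho>)\<^sup>2 + 4) * cos (2 * psi_s \<rho>) = - (1 - \<rho>)"
    and "sqrt ((1 - \<rho>)\<^sup>2 + 4) * sin (2 * psi_s \<rho>) = 2"
    using cos_sin_arctan_2_div[of "1 - \<rho>"] assms by (simp_all add: *)
qed

text \<open>For the antisymmetric block the common factor is
  \<open>\<rho> * (1 - \<rho>) / 2\<close>, leaving \<open>1 + \<rho>\<close> and 2.\<close>

lemma cos_sin_double_psi_a:
  assumes "- 1 < \<rho>"
  shows "sqrt ((1 + \<rho>)\<^sup>2 + 4) * cos (2 * psi_a \<rho>) = 1 + \<rho>"
    and "sqrt ((1 + \<rho>)\<^sup>2 + 4) * sin (2 * psi_a \<rho>) = 2"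
  using cos_sin_arctan_2_div[of "1 + \<rho>"] assms by (simp_all add: psi_a_def)

section \<open>Eigenvalues and their interlacing\<close>

text \<open>
  The eigenvalues of a symmetric \<open>2 \<times> 2\<close> block with diagonal \<open>a, d\<close> and off-diagonal \<open>b\<close> are
  \<open>(a + d) / 2 \<plusminus> sqrt (((a - d) / 2)\<^sup>2 + b\<^sup>2)\<close>; entries 0 and 2 come from the symmetric block,
  1 and 3 from the antisymmetric one.
\<close>

definition KLT4_eigenvalue :: "real \<Rightarrow> nat \<Rightarrow> real" where
  "KLT4_eigenvalue \<rho> i =
     (let m = (\<rho> + \<rho> ^ 3) / 2;
          ds = \<rho> * (1 + \<rho>) / 2 * sqrt ((1 - \<rho>)\<^sup>2 + 4);
          da = \<rho> * (1 - \<rho>) / 2 * sqrt ((1 + \<rho>)\<^sup>2 + 4)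
      in [1 + m + ds, 1 - m + da, 1 + m - ds, 1 - m - da] ! i)"

text \<open>The successive gaps are \<open>2 * m + ds - da\<close>, \<open>ds + da - 2 * m\<close>
  and \<open>2 * m - (ds - da)\<close>. Up to the factor \<open>\<rho> / 2\<close>,
  \<open>ds\<close>, \<open>da\<close>, \<open>2 * m\<close> are \<open>x\<close>, \<open>y\<close>,
  \<open>2 * (1 + \<rho>\<^sup>2)\<close>, so bounds on \<open>x + y\<close> and
  \<open>x - y\<close> suffice.\<close>

lemma KLT4_eigenvalue_decreasing:
  assumes "0 < \<rho>" "\<rho> < 1" "i < j" "j < 4"
  shows "KLT4_eigenvalue \<rho> j < KLT4_eigenvalue \<rho> i"
proof -
  define x where "x = (1 + \<rho>) * sqrt ((1 - \<rho>)\<^sup>2 + 4)"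
  define y where "y = (1 - \<rho>) * sqrt ((1 + \<rho>)\<^sup>2 + 4)"
  have "sqrt ((1 - \<rho>)\<^sup>2 + 4) > 2" "sqrt ((1 + \<rho>)\<^sup>2 + 4) > 2"
    using assms by (auto intro!: real_less_rsqrt)
  then have "x > (1 + \<rho>) * 2" and "y > (1 - \<rho>) * 2"
    unfolding x_def y_def using assms by (intro mult_strict_left_mono; simp)+
  then have sum: "x + y > 4" by simp
  have "\<rho>\<^sup>2 < 1" using assms by (simp add: power_less_one_iff)
  \<comment> \<open>The difference of squares removes both roots; with \<open>x + y > 4\<close> it
    bounds \<open>x - y\<close> on both sides.\<close>
  have "(x - y) * (x + y) = x\<^sup>2 - y\<^sup>2" by (simp add: power2_eq_square algebra_simps)
  also have "\<dots> = (1 + \<rho>)\<^sup>2 * ((1 - \<rho>)\<^sup>2 + 4) - (1 - \<rho>)\<^sup>2 * ((1 + \<rho>)\<^sup>2 + 4)"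
    by (simp add: x_def y_def power_mult_distrib add_nonneg_nonneg)
  also have "\<dots> = 16 * \<rho>" by (simp add: power2_eq_square algebra_simps)
  finally have prod: "(x - y) * (x + y) = 16 * \<rho>" .
  have pos: "x - y > 0"
    using prod sum assms zero_less_mult_pos2[of "x - y" "x + y"] by simp
  have "(x - y) * 4 < (x - y) * (x + y)"
    using pos sum by (intro mult_strict_left_mono) auto
  then have "x - y < 4 * \<rho>" using prod by simp
  moreover have "4 * \<rho> \<le> 2 * (1 + \<rho>\<^sup>2)"
    using zero_le_power2[of "1 - \<rho>"] by (simp add: power2_eq_square algebra_simps)
  ultimately have diff: "x - y < 2 * (1 + \<rho>\<^sup>2)" by simp
  have *: "\<rho> / 2 * (x - y) > 0" "\<rho> / 2 * (2 * (1 + \<rho>\<^sup>2)) < \<rho> / 2 * (x + y)"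
    "\<rho> / 2 * (x - y) < \<rho> / 2 * (2 * (1 + \<rho>\<^sup>2))"
    using assms pos diff sum \<open>\<rho>\<^sup>2 < 1\<close> by (auto intro!: mult_strict_left_mono)
  define m ds da where "m = (\<rho> + \<rho> ^ 3) / 2" and "ds = \<rho> * x / 2" and "da = \<rho> * y / 2"
  have ord: "da < ds" "2 * m < ds + da" "ds - da < 2 * m"
    using * \<open>0 < \<rho>\<close> unfolding m_def ds_def da_def
    by (simp_all add: algebra_simps power2_eq_square power3_eq_cube)
  have "0 < m" using assms by (simp add: m_def add_pos_pos)
  have "\<rho> * (1 + \<rho>) / 2 * sqrt ((1 - \<rho>)\<^sup>2 + 4) = ds"
    and "\<rho> * (1 - \<rho>) / 2 * sqrt ((1 + \<rho>)\<^sup>2 + 4) = da"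
    by (simp_all add: x_def y_def ds_def da_def)
  then have ev: "KLT4_eigenvalue \<rho> k = [1 + m + ds, 1 - m + da, 1 + m - ds, 1 - m - da] ! k" for k
    by (simp only: KLT4_eigenvalue_def Let_def m_def)
  have step: "KLT4_eigenvalue \<rho> (Suc k) < KLT4_eigenvalue \<rho> k" if "k < 3" for k
  proof -
    from that consider "k = 0" | "k = 1" | "k = 2" by linarith
    then show ?thesis
      using ord \<open>0 < m\<close> by cases (simp_all add: ev)
  qed
  show ?thesis
    using \<open>i < j\<close> \<open>j < 4\<close>
  proof (induction j)
    case (Suc j)
    then show ?case using step[of j] by (cases "i = j") auto
  qed simp
qed

section \<open>The rows as eigenvectors\<close>

text \<open>Each folded block is its mean diagonal times the identity plus a multiple of a traceless
  symmetric matrix, which is \<open>rs\<close> or \<open>ra\<close> times a reflection. The vector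
  at angle \<open>\<psi>\<close> is fixed by that reflection and the perpendicular one is negated,
  giving the two signs.\<close>

lemma butterfly_rotations_eigenvector:
  assumes "0 < \<rho>" "\<rho> < 1" "i < 4"
  shows "eigenvector (AR1 4 \<rho>) (row (butterfly_rotations \<rho>) i) (KLT4_eigenvalue \<rho> i)"
proof -
  define c s c' s' where "c = cos (psi_s \<rho>) / sqrt 2" and "s = sin (psi_s \<rho>) / sqrt 2"
    and "c' = cos (psi_a \<rho>) / sqrt 2" and "s' = sin (psi_a \<rho>) / sqrt 2"
  define rs ra where "rs = sqrt ((1 - \<rho>)\<^sup>2 + 4)" and "ra = sqrt ((1 + \<rho>)\<^sup>2 + 4)"
  \<comment> \<open>The double negation \<open>- (- s')\<close> matches the antisymmetric pattern
    with \<open>x = - s'\<close>.\<close>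
  have row: "row (butterfly_rotations \<rho>) i = vec 4 ((!) ([[c, s, s, c],
    [c', s', - s', - c'], [- s, c, c, - s], [- s', c', - c', - (- s')]] ! i))"
    using assms(3) unfolding butterfly_rotations_eq c_def s_def c'_def s'_def
    by (auto simp: less_4_cases
        intro!: eq_vecI)
  have nz: "c \<noteq> 0 \<or> s \<noteq> 0" "c' \<noteq> 0 \<or> s' \<noteq> 0"
    using sin_zero_abs_cos_one[of "psi_s \<rho>"] sin_zero_abs_cos_one[of "psi_a \<rho>"]
    unfolding c_def s_def c'_def s'_def by auto
  have "rs * cos (psi_s \<rho>) =
      rs * (cos (2 * psi_s \<rho>) * cos (psi_s \<rho>) + sin (2 * psi_s \<rho>) * sin (psi_s \<rho>))"
    "rs * sin (psi_s \<rho>) =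
      rs * (sin (2 * psi_s \<rho>) * cos (psi_s \<rho>) - cos (2 * psi_s \<rho>) * sin (psi_s \<rho>))"
    "ra * cos (psi_a \<rho>) =
      ra * (cos (2 * psi_a \<rho>) * cos (psi_a \<rho>) + sin (2 * psi_a \<rho>) * sin (psi_a \<rho>))"
    "ra * sin (psi_a \<rho>) =
      ra * (sin (2 * psi_a \<rho>) * cos (psi_a \<rho>) - cos (2 * psi_a \<rho>) * sin (psi_a \<rho>))"
    by (simp_all only: double_angle_cos_sin)
  moreover have "rs * cos (2 * psi_s \<rho>) = - (1 - \<rho>)" "rs * sin (2 * psi_s \<rho>) = 2"
    "ra * cos (2 * psi_a \<rho>) = 1 + \<rho>" "ra * sin (2 * psi_a \<rho>) = 2"
    using cos_sin_double_psi_s cos_sin_double_psi_a assms by (simp_all add: rs_def ra_def)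
  ultimately have
    "rs * cos (psi_s \<rho>) = - (1 - \<rho>) * cos (psi_s \<rho>) + 2 * sin (psi_s \<rho>)"
    "rs * sin (psi_s \<rho>) = 2 * cos (psi_s \<rho>) + (1 - \<rho>) * sin (psi_s \<rho>)"
    "ra * cos (psi_a \<rho>) = (1 + \<rho>) * cos (psi_a \<rho>) + 2 * sin (psi_a \<rho>)"
    "ra * sin (psi_a \<rho>) = 2 * cos (psi_a \<rho>) - (1 + \<rho>) * sin (psi_a \<rho>)"
    by (simp_all only: distrib_left right_diff_distrib mult.assoc[symmetric] minus_mult_left[symmetric])
  \<comment> \<open>Used as rewrite rules, these eliminate the roots \<open>rs\<close> and
    \<open>ra\<close>, so each eigenvalue equation becomes a polynomial identity.\<close>
  then have rot: "rs * c = - (1 - \<rho>) * c + 2 * s" "rs * s = 2 * c + (1 - \<rho>) * s"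
    "ra * c' = (1 + \<rho>) * c' + 2 * s'" "ra * s' = 2 * c' - (1 + \<rho>) * s'"
    unfolding c_def s_def c'_def s'_def times_divide_eq_right
    by (simp_all only: add_divide_distrib diff_divide_distrib)
  note ev = KLT4_eigenvalue_def Let_def rs_def[symmetric] ra_def[symmetric]
  from assms(3) consider "i = 0" | "i = 1" | "i = 2" | "i = 3" by linarith
  then show ?thesis
  proof cases
    case 1
    have "eigenvector (AR1 4 \<rho>) (vec 4 ((!) [c, s, s, c]))
        (1 + (\<rho> + \<rho> ^ 3) / 2 + \<rho> * (1 + \<rho>) / 2 * rs)"
      using nz
      by (intro AR1_4_eigenvector_symmetric; simp only: distrib_right left_diff_distrib mult.assoc
        mult_minus_right rot; auto simp: field_simps power2_eq_square power3_eq_cube)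
    then show ?thesis unfolding row by (simp add: 1 ev)
  next
    case 2
    have "eigenvector (AR1 4 \<rho>) (vec 4 ((!) [c', s', - s', - c']))
        (1 - (\<rho> + \<rho> ^ 3) / 2 + \<rho> * (1 - \<rho>) / 2 * ra)"
      using nz
      by (intro AR1_4_eigenvector_antisymmetric; simp only: distrib_right left_diff_distrib mult.assoc
        mult_minus_right rot; auto simp: field_simps power2_eq_square power3_eq_cube)
    then show ?thesis unfolding row by (simp add: 2 ev)
  next
    case 3
    have "eigenvector (AR1 4 \<rho>) (vec 4 ((!) [- s, c, c, - s]))
        (1 + (\<rho> + \<rho> ^ 3) / 2 - \<rho> * (1 + \<rho>) / 2 * rs)"
      using nz
      by (intro AR1_4_eigenvector_symmetric; simp only: distrib_right left_diff_distrib mult.assoc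
        mult_minus_right rot; auto simp: field_simps power2_eq_square power3_eq_cube)
    then show ?thesis unfolding row by (simp add: 3 ev)
  next
    case 4
    have "eigenvector (AR1 4 \<rho>) (vec 4 ((!) [- s', c', - c', - (- s')]))
        (1 - (\<rho> + \<rho> ^ 3) / 2 - \<rho> * (1 - \<rho>) / 2 * ra)"
      using nz
      by (intro AR1_4_eigenvector_antisymmetric; simp only: distrib_right left_diff_distrib mult.assoc
        mult_minus_right rot; auto simp: field_simps power2_eq_square power3_eq_cube)
    then show ?thesis unfolding row by (simp add: 4 ev)
  qed
qed

section \<open>Existence and uniqueness of the transform\<close>

lemma butterfly_rotations_carrier: "butterfly_rotations \<rho> \<in> carrier_mat 4 4"
  by (simp add: butterfly_rotations_eq)

lemma butterfly_rotations_orthogonal: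
  "butterfly_rotations \<rho> * (butterfly_rotations \<rho>)\<^sup>T = 1\<^sub>m 4"
proof -
  define c s c' s' where "c = cos (psi_s \<rho>) / sqrt 2" and "s = sin (psi_s \<rho>) / sqrt 2"
    and "c' = cos (psi_a \<rho>) / sqrt 2" and "s' = sin (psi_a \<rho>) / sqrt 2"
  \<comment> \<open>Each square occurs twice in a row, so one half yields unit norm.\<close>
  have "c * c + s * s = 1 / 2" "c' * c' + s' * s' = 1 / 2"
    using sin_cos_squared_add3[of "psi_s \<rho>"] sin_cos_squared_add3[of "psi_a \<rho>"]
    unfolding c_def s_def c'_def s'_def by (simp_all add: add_divide_distrib[symmetric])
  then show ?thesis
    unfolding butterfly_rotations_eq c_def[symmetric] s_def[symmetric]
      c'_def[symmetric] s'_def[symmetric]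
    by (intro eq_matI)
      (auto simp: scalar_prod_def sum_upt_4 less_4_cases algebra_simps)
qed

lemma is_KLT_butterfly_rotations:
  assumes "0 < \<rho>" "\<rho> < 1"
  shows "is_KLT 4 \<rho> (butterfly_rotations \<rho>)"
  unfolding is_KLT_def
  using butterfly_rotations_carrier butterfly_rotations_orthogonal
    butterfly_rotations_eigenvector[OF assms] KLT4_eigenvalue_decreasing[OF assms]
  by (meson less_imp_le)

lemma is_KLT_4_unique:
  assumes "0 < \<rho>" "\<rho> < 1" "is_KLT 4 \<rho> W"
  shows "eq_up_to_row_signs W (butterfly_rotations \<rho>)"
  using assms(3) unfolding is_KLT_def
  by (elim conjE exE, intro eq_up_to_row_signs_if_eigenvectors[OF AR1_carrier AR1_transpose
      butterfly_rotations_carrier butterfly_rotations_orthogonal])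
    (use assms butterfly_rotations_eigenvector KLT4_eigenvalue_decreasing in auto)

section \<open>Tangents and limits of the angles\<close>

text \<open>At the poles, \<open>\<rho> = 1\<close> and \<open>\<rho> = - 1\<close> respectively,
  division by zero yields 0 on both sides.\<close>

lemma tan_double_psi:
  shows "tan (2 * psi_s \<rho>) = - 2 / (1 - \<rho>)" and "tan (2 * psi_a \<rho>) = 2 / (1 + \<rho>)"
proof -
  have "2 * psi_s \<rho> = pi - arctan (2 / (1 - \<rho>))" by (simp add: psi_s_def)
  then show "tan (2 * psi_s \<rho>) = - 2 / (1 - \<rho>)"
    using tan_minus[of "arctan (2 / (1 - \<rho>))"] tan_periodic_pi[of "- arctan (2 / (1 - \<rho>))"]
    by (simp add: tan_arctan)
  show "tan (2 * psi_a \<rho>) = 2 / (1 + \<rho>)" by (simp add: psi_a_def tan_arctan)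
qed

lemma psi_tendsto_at_left_1:
  "((\<lambda>\<rho>. (psi_s \<rho>, psi_a \<rho>)) \<longlongrightarrow> (pi / 4, pi / 8)) (at_left 1)"
proof -
  \<comment> \<open>The argument of the arctangent has a pole at 1, so continuity cannot be used;
    the left-hand side supplies the sign.\<close>
  have "filterlim (\<lambda>\<rho>::real. 2 / (1 - \<rho>)) at_top (at_left 1)"
    by real_asymp
  then have "((\<lambda>\<rho>. arctan (2 / (1 - \<rho>))) \<longlongrightarrow> pi / 2) (at_left 1)"
    by (rule filterlim_compose[OF tendsto_arctan_at_top])
  then have "(psi_s \<longlongrightarrow> pi / 2 - 1 / 2 * (pi / 2)) (at_left 1)"
    unfolding psi_s_def by (intro tendsto_intros)
  moreover have "(psi_a \<longlongrightarrow> 1 / 2 * arctan (2 / (1 + 1))) (at_left 1)"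
    unfolding psi_a_def by (intro tendsto_intros) auto
  ultimately show ?thesis
    by (intro tendsto_Pair) (simp_all add: arctan_one)
qed

text \<open>The reciprocal \<open>x\<close> of the golden ratio satisfies
  \<open>x\<^sup>2 = 1 - x\<close>, so \<open>2 * x / (1 - x\<^sup>2) = 2\<close> and the
  double-angle formula applies.\<close>

lemma arctan_golden_ratio: "arctan ((1 + sqrt 5) / 2) = pi / 2 - 1 / 2 * arctan 2"
proof -
  define x :: real where "x = (sqrt 5 - 1) / 2"
  have "sqrt 5 * sqrt 5 = (5 :: real)" by simp
  then have x2: "x\<^sup>2 = 1 - x" and inv: "x * ((1 + sqrt 5) / 2) = 1"
    unfolding x_def by (simp_all add: power2_eq_square field_simps)
  have "x > 0" unfolding x_def by simp
  moreover have "x < 1"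
    \<comment> \<open>\<open>sqrt 5 < 3\<close> places \<open>x\<close> in the range of the
      arctangent double-angle formula.\<close>
    using real_sqrt_less_mono[of 5 "3\<^sup>2"] unfolding x_def real_sqrt_abs by simp
  ultimately have "2 * arctan x = arctan 2"
    using arctan_double[of x] by (simp add: x2)
  moreover have "(1 + sqrt 5) / 2 = 1 / x"
    using inv \<open>x > 0\<close> by (simp add: field_simps)
  moreover have "arctan (1 / x) = pi / 2 - arctan x"
    using arctan_inverse[of x] \<open>x > 0\<close> by simp
  ultimately show ?thesis by simp
qed

lemma psi_tendsto_at_right_0:
  "((\<lambda>\<rho>. (psi_s \<rho>, psi_a \<rho>)) \<longlongrightarrow> (arctan ((1 + sqrt 5) / 2), 1 / 2 * arctan 2)) (at_right 0)"
proof -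
  \<comment> \<open>Both angles are continuous at 0, so the limits are the values there.\<close>
  have "(psi_s \<longlongrightarrow> pi / 2 - 1 / 2 * arctan (2 / (1 - 0))) (at_right 0)"
    unfolding psi_s_def by (intro tendsto_intros) auto
  moreover have "(psi_a \<longlongrightarrow> 1 / 2 * arctan (2 / (1 + 0))) (at_right 0)"
    unfolding psi_a_def by (intro tendsto_intros) auto
  ultimately show ?thesis
    unfolding arctan_golden_ratio by (intro tendsto_Pair) simp_all
qed

theorem mainTheorem3:
  "(\<forall>\<rho> :: real. 0 < \<rho> \<and> \<rho> < 1 \<longrightarrow>
      tan (2 * psi_s \<rho>) = - 2 / (1 - \<rho>) \<and>
      tan (2 * psi_a \<rho>) = 2 / (1 + \<rho>) \<and>
      is_KLT 4 \<rho> (butterfly_rotations \<rho>) \<and>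
      (\<forall>W. is_KLT 4 \<rho> W \<longrightarrow> eq_up_to_row_signs W (butterfly_rotations \<rho>)))
   \<and> ((\<lambda>\<rho>. (psi_s \<rho>, psi_a \<rho>)) \<longlongrightarrow> (pi / 4, pi / 8)) (at_left 1)
   \<and> ((\<lambda>\<rho>. (psi_s \<rho>, psi_a \<rho>)) \<longlongrightarrow> (arctan ((1 + sqrt 5) / 2), 1 / 2 * arctan 2)) (at_right 0)"
  using tan_double_psi is_KLT_butterfly_rotations is_KLT_4_unique
    psi_tendsto_at_left_1 psi_tendsto_at_right_0 by blast

end
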